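(* Let $G$ be a finite group with a core-free subgroup $H$ such that the interval $[H,G]$ is bottom Boolean and has nonzero dual Euler totient $\hat{\varphi}(H,G)$. Then $G$ is linearly primitive.
   Context: A proper subgroup $H$ of $G$ is core-free if it does not contain any non-trivial normal subgroup of $G$. A group $G$ is linearly primitive if it has a faithful irreducible complex representation. $[H,G]$ denotes the lattice of all subgroups $K$ with $H \subseteq K \subseteq G$. Its bottom interval is $[H,B]$, where $B$ is the join of all the atoms of $[H,G]$. A lattice is Boolean if it is isomorphic to the lattice of subsets of a finite set. $[H,G]$ is bottom Boolean if its bottom interval is a Boolean lattice. The dual Euler totient is $\hat{\varphi}(H,G) := \sum_{K \in [H,G]} \mu(H,K)\,|G:K|$, with $\mu$ the Möbius function of the lattice $[H,G]$. *)

theory Defs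
  imports "HOL-Algebra.Algebra" "Jordan_Normal_Form.VS_Connect"
begin

section \<open>Finite lattices\<close>

text \<open>The order-theoretic part is built on the ordered sets of \<^theory>\<open>HOL-Algebra.Order\<close>, so that
  bottom elements, joins, closed intervals and order embeddings are the library's.\<close>

definition atoms :: "('a, 'b) gorder_scheme \<Rightarrow> 'a set" where
  "atoms L = {a \<in> carrier L. \<bottom>\<^bsub>L\<^esub> \<sqsubset>\<^bsub>L\<^esub> a \<and> \<not> (\<exists>z \<in> carrier L. \<bottom>\<^bsub>L\<^esub> \<sqsubset>\<^bsub>L\<^esub> z \<and> z \<sqsubset>\<^bsub>L\<^esub> a)}"

definition bottom_interval :: "('a, 'b) gorder_scheme \<Rightarrow> ('a, 'b) gorder_scheme" where
  "bottom_interval L = L\<lparr>carrier := \<lbrace>\<bottom>\<^bsub>L\<^esub>..\<Squnion>\<^bsub>L\<^esub> (atoms L)\<rbrace>\<^bsub>L\<^esub>\<rparr>"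

definition subset_lattice :: "'s set \<Rightarrow> 's set gorder" where
  "subset_lattice S = \<lparr>carrier = Pow S, eq = (=), le = (\<subseteq>)\<rparr>"

text \<open>An isomorphism of lattices is a bijection that preserves and reflects the order. Every finite
  set is equipotent to a finite set of natural numbers, so the choice of \<^typ>\<open>nat\<close> is harmless.\<close>

definition boolean_lattice :: "('a, 'b) gorder_scheme \<Rightarrow> bool" where
  "boolean_lattice L \<longleftrightarrow>
     (\<exists>(S :: nat set) f. finite S \<and>
        bij_betw f (carrier L) (carrier (subset_lattice S)) \<and> order_emb L (subset_lattice S) f)"

definition bottom_boolean :: "('a, 'b) gorder_scheme \<Rightarrow> bool" where
  "bottom_boolean L \<longleftrightarrow> boolean_lattice (bottom_interval L)"

text \<open>The usual recursion \<open>\<mu>(x,x) = 1\<close> and \<open>\<mu>(x,y) = - (\<Sum>x \<le> z < y. \<mu>(x,z))\<close> for \<open>x < y\<close>.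
  The value 0 is used unless \<open>x \<le> y\<close> in a finite partial order; the guard makes the recursion
  terminate.\<close>

function moebius :: "('a, 'b) gorder_scheme \<Rightarrow> 'a \<Rightarrow> 'a \<Rightarrow> int" where
  "moebius L x y =
     (if partial_order L \<and> finite (carrier L) \<and> x \<in> carrier L \<and> y \<in> carrier L \<and> x \<sqsubseteq>\<^bsub>L\<^esub> y
      then if x = y then 1
           else - (\<Sum>z \<in> {z \<in> carrier L. x \<sqsubseteq>\<^bsub>L\<^esub> z \<and> z \<sqsubset>\<^bsub>L\<^esub> y}. moebius L x z)
      else 0)"
  by pat_completeness auto
termination
proof (relation "measure (\<lambda>(L, x, y). card {z \<in> carrier L. z \<sqsubset>\<^bsub>L\<^esub> y})", simp)
  fix L :: "('a, 'b) gorder_scheme" and x y z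
  assume L: "partial_order L \<and> finite (carrier L) \<and> x \<in> carrier L \<and> y \<in> carrier L \<and> x \<sqsubseteq>\<^bsub>L\<^esub> y"
    and z: "z \<in> {z \<in> carrier L. x \<sqsubseteq>\<^bsub>L\<^esub> z \<and> z \<sqsubset>\<^bsub>L\<^esub> y}"
  interpret partial_order L using L by blast
  have "{w \<in> carrier L. w \<sqsubset>\<^bsub>L\<^esub> z} \<subset> {w \<in> carrier L. w \<sqsubset>\<^bsub>L\<^esub> y}"
    using L z by (auto simp: lless_eq intro: le_trans)
  then show "((L, x, z), (L, x, y)) \<in> measure (\<lambda>(L, x, y). card {z \<in> carrier L. z \<sqsubset>\<^bsub>L\<^esub> y})"
    using L by (auto intro!: psubset_card_mono)
qed

declare moebius.simps [simp del]


section \<open>Intervals of subgroups\<close>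

definition overgroup_lattice :: "('a, 'b) monoid_scheme \<Rightarrow> 'a set \<Rightarrow> 'a set gorder" where
  "overgroup_lattice G H = \<lparr>carrier = {K. subgroup K G \<and> H \<subseteq> K}, eq = (=), le = (\<subseteq>)\<rparr>"

definition core_free :: "('a, 'b) monoid_scheme \<Rightarrow> 'a set \<Rightarrow> bool" where
  "core_free G H \<longleftrightarrow>
     subgroup H G \<and> H \<noteq> carrier G \<and> (\<forall>N. N \<lhd> G \<and> N \<subseteq> H \<longrightarrow> N = {\<one>\<^bsub>G\<^esub>})"

definition dual_totient :: "('a, 'b) monoid_scheme \<Rightarrow> 'a set \<Rightarrow> int" where
  "dual_totient G H =
     (\<Sum>K \<in> carrier (overgroup_lattice G H).
        moebius (overgroup_lattice G H) H K * int (card (rcosets\<^bsub>G\<^esub> K)))"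


section \<open>Complex representations\<close>

text \<open>Representations are taken on the spaces of column vectors \<open>\<complex>\<^sup>n\<close>, i.e. as homomorphisms into the
  invertible complex \<open>n\<close> by \<open>n\<close> matrices. Every finite-dimensional representation is of this form
  up to a choice of basis, and irreducible representations of finite groups are finite-dimensional.\<close>

abbreviation general_linear_group :: "nat \<Rightarrow> complex mat monoid" where
  "general_linear_group n \<equiv> units_of (ring_mat TYPE(complex) n ())"

definition representation ::
    "('a, 'b) monoid_scheme \<Rightarrow> nat \<Rightarrow> ('a \<Rightarrow> complex mat) \<Rightarrow> bool" where
  "representation G n \<rho> \<longleftrightarrow> \<rho> \<in> hom G (general_linear_group n)"

definition faithful_representation ::
    "('a, 'b) monoid_scheme \<Rightarrow> nat \<Rightarrow> ('a \<Rightarrow> complex mat) \<Rightarrow> bool" where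
  "faithful_representation G n \<rho> \<longleftrightarrow> representation G n \<rho> \<and> inj_on \<rho> (carrier G)"

definition irreducible_representation ::
    "('a, 'b) monoid_scheme \<Rightarrow> nat \<Rightarrow> ('a \<Rightarrow> complex mat) \<Rightarrow> bool" where
  "irreducible_representation G n \<rho> \<longleftrightarrow>
     representation G n \<rho> \<and> n > 0 \<and>
     (\<forall>W. VectorSpace.subspace class_ring W (module_vec TYPE(complex) n) \<and>
          (\<forall>g \<in> carrier G. \<forall>w \<in> W. \<rho> g *\<^sub>v w \<in> W) \<longrightarrow>
          W = {0\<^sub>v n} \<or> W = carrier_vec n)"

definition linearly_primitive :: "('a, 'b) monoid_scheme \<Rightarrow> bool" where
  "linearly_primitive G \<longleftrightarrow>
     (\<exists>n \<rho>. faithful_representation G n \<rho> \<and> irreducible_representation G n \<rho>)"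

end

theory Submission
  imports Defs "Jordan_Normal_Form.DL_Rank"
begin

text \<open>For a function \<open>\<chi>\<close> on \<open>G\<close> let \<open>S(\<chi>) = \<Sum>\<^sub>K \<mu>(H,K) avg\<^sub>K(\<chi>)\<close>, where \<open>avg\<^sub>K\<close> is the mean
  over \<open>K\<close>; if \<open>\<chi>\<close> is the character of \<open>V\<close>, then \<open>avg\<^sub>K(\<chi>)\<close> is the dimension of the space of \<open>K\<close>-fixed
  vectors of \<open>V\<close>. The character of the regular representation gives the dual totient, so some
  character has \<open>S \<noteq> 0\<close>, and one of minimal degree belongs to an irreducible \<open>V\<close>, because characters
  add up along invariant subspaces. Let \<open>N\<close> be the kernel of \<open>V\<close>. Then \<open>avg\<^sub>K\<close> and \<open>avg\<^sub>K\<^sub>N\<close> agree on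
  its character, so if \<open>N\<close> were not contained in \<open>H\<close>, Weisner's theorem for the join with \<open>HN\<close> would
  force \<open>S = 0\<close>. Hence \<open>N \<subseteq> H\<close>, and \<open>N\<close> is trivial because \<open>H\<close> is core-free.\<close>

section \<open>Moebius functions\<close>

lemma moebius_eq_0:
  assumes "\<not> x \<sqsubseteq>\<^bsub>L\<^esub> y"
  shows "moebius L x y = 0"
  using assms by (simp add: moebius.simps[of L x y])

context partial_order
begin

text \<open>The defining recursion, summed over the whole down-set of \<open>y\<close> instead of
  the interval from \<open>x\<close> to \<open>y\<close>. The extra terms vanish because
  \<open>moebius\<close> is 0 unless its arguments are comparable. Down-sets are what a closure
  operator partitions.\<close>

lemma sum_moebius_below:
  assumes fin: "finite (carrier L)" and x: "x \<in> carrier L" and y: "y \<in> carrier L" and "x \<noteq> y"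
  shows "(\<Sum>z \<in> {z \<in> carrier L. z \<sqsubseteq> y}. moebius L x z) = 0"
proof (cases "x \<sqsubseteq> y")
  case False
  \<comment> \<open>Nothing below \<open>y\<close> lies above \<open>x\<close>, so every summand has
    the default value 0.\<close>
  then show ?thesis
    using x y by (intro sum.neutral) (auto intro!: moebius_eq_0 dest: le_trans)
next
  case True
  have "(\<Sum>z \<in> {z \<in> carrier L. z \<sqsubseteq> y}. moebius L x z)
      = (\<Sum>z \<in> insert y {z \<in> carrier L. x \<sqsubseteq> z \<and> z \<sqsubset> y}. moebius L x z)"
  proof (rule sum.mono_neutral_right)
    show "\<forall>z \<in> {z \<in> carrier L. z \<sqsubseteq> y} - insert y {z \<in> carrier L. x \<sqsubseteq> z \<and> z \<sqsubset> y}. moebius L x z = 0"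
      by (auto simp: lless_eq moebius_eq_0)
  qed (use fin y in \<open>auto simp: lless_eq\<close>)
  also have "\<dots> = moebius L x y + (\<Sum>z \<in> {z \<in> carrier L. x \<sqsubseteq> z \<and> z \<sqsubset> y}. moebius L x z)"
    using fin by (intro sum.insert) (auto simp: lless_eq)
  also have "moebius L x y = - (\<Sum>z \<in> {z \<in> carrier L. x \<sqsubseteq> z \<and> z \<sqsubset> y}. moebius L x z)"
    using assms True partial_order_axioms by (simp add: moebius.simps[of L x y])
  finally show ?thesis by simp
qed

text \<open>Weisner's theorem, with the join with a fixed element replaced by any closure operator that
  does not fix the base point.\<close>

lemma sum_moebius_closure_fibre:
  assumes fin: "finite (carrier L)" and x: "x \<in> carrier L" "x \<notin> j ` carrier L"
    and j: "j ` carrier L \<subseteq> carrier L"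
    and closure: "\<And>y z. \<lbrakk>y \<in> j ` carrier L; z \<in> carrier L\<rbrakk> \<Longrightarrow> j z \<sqsubseteq> y \<longleftrightarrow> z \<sqsubseteq> y"
    and y: "y \<in> j ` carrier L"
  shows "(\<Sum>z \<in> {z \<in> carrier L. j z = y}. moebius L x z) = 0"
  using y
proof (induction "card {z \<in> carrier L. z \<sqsubset> y}" arbitrary: y rule: less_induct)
  case less
  let ?C = "{w \<in> j ` carrier L. w \<sqsubseteq> y}"
  let ?fibre_sum = "\<lambda>w. \<Sum>z \<in> {z \<in> carrier L. j z = w}. moebius L x z"
  \<comment> \<open>Every closed element differs from \<open>x\<close>; hence the Moebius sum over
    its down-set is 0 and not 1.\<close>
  have y: "y \<in> carrier L" "y \<noteq> x" using less.prems x j by auto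
  have zero: "?fibre_sum w = 0" if w: "w \<in> ?C - {y}" for w
  proof (rule less.hyps)
    have "w \<in> carrier L" using w j by auto
    then have "{z \<in> carrier L. z \<sqsubset> w} \<subset> {z \<in> carrier L. z \<sqsubset> y}"
      using w y by (auto simp: lless_eq intro: le_trans)
    then show "card {z \<in> carrier L. z \<sqsubset> w} < card {z \<in> carrier L. z \<sqsubset> y}"
      using fin by (intro psubset_card_mono) auto
    show "w \<in> j ` carrier L" using w by auto
  qed
  \<comment> \<open>By the closure property, the down-set of the closed element \<open>y\<close> is
    the disjoint union of the fibres over the closed elements of \<open>?C\<close>. By induction,
    all of these except the fibre over \<open>y\<close> sum to 0, so the last one does too.\<close>
  have "z \<sqsubseteq> y" if "z \<in> carrier L" "j z \<in> ?C" for z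
    using that closure[OF less.prems] by simp
  then have eq: "{z \<in> {z \<in> carrier L. z \<sqsubseteq> y}. j z = w} = {z \<in> carrier L. j z = w}" if "w \<in> ?C" for w
    using that by auto
  have "0 = (\<Sum>z \<in> {z \<in> carrier L. z \<sqsubseteq> y}. moebius L x z)"
    using sum_moebius_below[OF fin x(1) y(1)] y by simp
  also have "\<dots> = (\<Sum>w \<in> ?C. \<Sum>z \<in> {z \<in> {z \<in> carrier L. z \<sqsubseteq> y}. j z = w}. moebius L x z)"
    using fin closure[OF less.prems] by (intro sum.group[symmetric]) auto
  also have "\<dots> = (\<Sum>w \<in> ?C. ?fibre_sum w)"
    using eq by (intro sum.cong) auto
  also have "\<dots> = ?fibre_sum y + (\<Sum>w \<in> ?C - {y}. ?fibre_sum w)"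
    using fin less.prems y by (intro sum.remove) auto
  also have "(\<Sum>w \<in> ?C - {y}. ?fibre_sum w) = 0"
    using zero by (intro sum.neutral) blast
  finally show ?case by simp
qed

text \<open>\<open>F\<close> is constant on each fibre of \<open>j\<close>, so it factors out of the
  fibre sums, and these vanish.\<close>

lemma sum_moebius_closure_invariant:
  fixes F :: "'a \<Rightarrow> 'c::comm_ring_1"
  assumes fin: "finite (carrier L)" and x: "x \<in> carrier L" "x \<notin> j ` carrier L"
    and j: "j ` carrier L \<subseteq> carrier L"
    and closure: "\<And>y z. \<lbrakk>y \<in> j ` carrier L; z \<in> carrier L\<rbrakk> \<Longrightarrow> j z \<sqsubseteq> y \<longleftrightarrow> z \<sqsubseteq> y"
    and F: "\<And>z. z \<in> carrier L \<Longrightarrow> F (j z) = F z"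
  shows "(\<Sum>z \<in> carrier L. of_int (moebius L x z) * F z) = 0"
proof -
  have "(\<Sum>z \<in> carrier L. of_int (moebius L x z) * F z)
      = (\<Sum>y \<in> j ` carrier L. \<Sum>z \<in> {z \<in> carrier L. j z = y}. of_int (moebius L x z) * F z)"
    using fin by (rule sum.image_gen)
  also have "\<dots> = (\<Sum>y \<in> j ` carrier L. of_int (\<Sum>z \<in> {z \<in> carrier L. j z = y}. moebius L x z) * F y)"
    by (simp add: sum_distrib_right) (auto intro!: sum.cong simp flip: F)
  also have "\<dots> = 0"
    using sum_moebius_closure_fibre[OF fin x j closure] by (intro sum.neutral) simp
  finally show ?thesis .
qed

end


section \<open>Averages over subgroups\<close>

definition average :: "'a set \<Rightarrow> ('a \<Rightarrow> complex) \<Rightarrow> complex" where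
  "average K \<chi> = (\<Sum>k \<in> K. \<chi> k) / of_nat (card K)"

text \<open>The functional \<open>S\<close> of the overview, taken on arbitrary complex functions so
  that it is visibly additive.\<close>

definition moebius_average :: "('a, 'b) monoid_scheme \<Rightarrow> 'a set \<Rightarrow> ('a \<Rightarrow> complex) \<Rightarrow> complex" where
  "moebius_average G H \<chi> =
     (\<Sum>K \<in> carrier (overgroup_lattice G H).
        of_int (moebius (overgroup_lattice G H) H K) * average K \<chi>)"

lemma moebius_average_add:
  "moebius_average G H (\<lambda>g. \<chi> g + \<psi> g) = moebius_average G H \<chi> + moebius_average G H \<psi>"
  by (simp add: moebius_average_def average_def sum.distrib add_divide_distrib distrib_left)

lemma moebius_average_cong:
  assumes "\<And>g. g \<in> carrier G \<Longrightarrow> \<chi> g = \<psi> g"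
  shows "moebius_average G H \<chi> = moebius_average G H \<psi>"
proof -
  have "average K \<chi> = average K \<psi>" if "subgroup K G" for K
    unfolding average_def using assms subgroup.mem_carrier[OF that] by (simp cong: sum.cong)
  then show ?thesis
    unfolding moebius_average_def by (intro sum.cong) (auto simp: overgroup_lattice_def)
qed

lemma partial_order_overgroup_lattice: "partial_order (overgroup_lattice G H)"
  by unfold_locales (auto simp: overgroup_lattice_def)

lemma finite_overgroup_lattice:
  assumes "finite (carrier G)"
  shows "finite (carrier (overgroup_lattice G H))"
  by (rule finite_subset[of _ "Pow (carrier G)"])
    (use assms in \<open>auto simp: overgroup_lattice_def dest: subgroup.mem_carrier\<close>)

context group
begin

text \<open>Double counting of \<chi>(kx) over k in \<open>K\<close> and x in
  \<open>K <#> N\<close>. For fixed k, left translation by k permutes \<open>K <#> N\<close>. For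
  fixed x = k0 n, the factor n does not affect \<chi>, and right translation by k0 permutes
  \<open>K\<close>.\<close>

lemma average_set_mult_invariant:
  assumes fin: "finite (carrier G)" and N: "subgroup N G" and K: "subgroup K G"
    and NK: "subgroup (K <#> N) G"
    and \<chi>: "\<And>g n. \<lbrakk>g \<in> carrier G; n \<in> N\<rbrakk> \<Longrightarrow> \<chi> (g \<otimes> n) = \<chi> g"
  shows "average (K <#> N) \<chi> = average K \<chi>"
proof -
  let ?M = "K <#> N"
  have KM: "K \<subseteq> ?M"
  proof
    fix k assume k: "k \<in> K"
    then have "k \<otimes> \<one> \<in> ?M" using subgroup.one_closed[OF N] by (auto simp: set_mult_def)
    then show "k \<in> ?M" using subgroup.mem_carrier[OF K k] by simp
  qed
  have pos: "card S > 0" if "subgroup S G" for S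
    using fin that by (rule subgroup.finite_imp_card_positive[rotated])
  have translate: "bij_betw (\<lambda>k. a \<otimes> k) S S" if S: "subgroup S G" and a: "a \<in> S" for a S
    by (rule bij_betwI[where g = "\<lambda>k. inv a \<otimes> k"])
      (use S a in \<open>auto simp: m_assoc[symmetric] subgroup.mem_carrier subgroup.m_closed subgroup.m_inv_closed\<close>)
  have translate': "bij_betw (\<lambda>k. k \<otimes> a) S S" if S: "subgroup S G" and a: "a \<in> S" for a S
    by (rule bij_betwI[where g = "\<lambda>k. k \<otimes> inv a"])
      (use S a in \<open>auto simp: m_assoc subgroup.mem_carrier subgroup.m_closed subgroup.m_inv_closed\<close>)
  have inner: "(\<Sum>k \<in> K. \<chi> (k \<otimes> x)) = (\<Sum>k \<in> K. \<chi> k)" if xM: "x \<in> ?M" for x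
  proof -
    obtain k0 n where x: "x = k0 \<otimes> n" "k0 \<in> K" "n \<in> N" using xM by (auto simp: set_mult_def)
    have "(\<Sum>k \<in> K. \<chi> (k \<otimes> x)) = (\<Sum>k \<in> K. \<chi> (k \<otimes> k0))"
      using x \<chi> K N by (intro sum.cong) (auto simp: m_assoc[symmetric] subgroup.mem_carrier)
    also have "\<dots> = (\<Sum>k \<in> K. \<chi> k)"
      using sum.reindex_bij_betw[OF translate'[OF K x(2)], of \<chi>] by simp
    finally show ?thesis .
  qed
  have "of_nat (card ?M) * (\<Sum>k \<in> K. \<chi> k) = (\<Sum>x \<in> ?M. \<Sum>k \<in> K. \<chi> (k \<otimes> x))"
    using inner by simp
  also have "\<dots> = (\<Sum>k \<in> K. \<Sum>x \<in> ?M. \<chi> (k \<otimes> x))"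
    by (rule sum.swap)
  also have "\<dots> = (\<Sum>k \<in> K. \<Sum>x \<in> ?M. \<chi> x)"
    using KM by (intro sum.cong sum.reindex_bij_betw[OF translate[OF NK]]) auto
  also have "\<dots> = of_nat (card K) * (\<Sum>x \<in> ?M. \<chi> x)"
    by simp
  finally show ?thesis
    using pos[OF K] pos[OF NK] by (simp add: average_def field_simps)
qed

text \<open>The map from K to KN is a closure operator on the overgroups of \<open>H\<close>, and by
  the previous lemma it preserves averages. Its closed elements contain \<open>N\<close>, so
  \<open>H\<close> is not closed and the weighted Moebius sum vanishes.\<close>

lemma moebius_average_normal_invariant:
  assumes fin: "finite (carrier G)" and H: "subgroup H G" and N: "N \<lhd> G" and NH: "\<not> N \<subseteq> H"
    and \<chi>: "\<And>g n. \<lbrakk>g \<in> carrier G; n \<in> N\<rbrakk> \<Longrightarrow> \<chi> (g \<otimes> n) = \<chi> g"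
  shows "moebius_average G H \<chi> = 0"
proof -
  define L where "L = overgroup_lattice G H"
  interpret L: partial_order L unfolding L_def by (rule partial_order_overgroup_lattice)
  have L: "carrier L = {K. subgroup K G \<and> H \<subseteq> K}" "le L = (\<subseteq>)"
    by (simp_all add: L_def overgroup_lattice_def)
  have sN: "subgroup N G" using N by (rule normal_imp_subgroup)
  \<comment> \<open>Normality of \<open>N\<close> makes the product set a subgroup, which is then
    the join of K and \<open>N\<close>.\<close>
  have sub: "subgroup (K <#> N) G" if "subgroup K G" for K
    using that N by (metis commut_normal mult_norm_subgroup)
  have N_sub: "N \<subseteq> K <#> N" and K_sub: "K \<subseteq> K <#> N" if K: "subgroup K G" for K
  proof -
    show "N \<subseteq> K <#> N"
    proof
      fix n assume n: "n \<in> N"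
      then have "\<one> \<otimes> n \<in> K <#> N" using subgroup.one_closed[OF K] by (auto simp: set_mult_def)
      then show "n \<in> K <#> N" using subgroup.mem_carrier[OF sN n] by simp
    qed
    show "K \<subseteq> K <#> N"
    proof
      fix k assume k: "k \<in> K"
      then have "k \<otimes> \<one> \<in> K <#> N" using subgroup.one_closed[OF sN] by (auto simp: set_mult_def)
      then show "k \<in> K <#> N" using subgroup.mem_carrier[OF K k] by simp
    qed
  qed
  have least: "K <#> N \<subseteq> M" if "subgroup M G" "K \<subseteq> M" "N \<subseteq> M" for K M
    using that by (auto simp: set_mult_def intro: subgroup.m_closed)
  have "(\<Sum>K \<in> carrier L. of_int (moebius L H K) * average K \<chi>) = 0"
  proof (rule L.sum_moebius_closure_invariant[where j = "\<lambda>K. K <#> N"])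
    show "finite (carrier L)" unfolding L_def using fin by (rule finite_overgroup_lattice)
    show "H \<in> carrier L" using H by (simp add: L)
    show "H \<notin> (\<lambda>K. K <#> N) ` carrier L" using NH N_sub by (auto simp: L)
    show "(\<lambda>K. K <#> N) ` carrier L \<subseteq> carrier L" using sub K_sub by (force simp: L)
    show "le L (Z <#> N) Y \<longleftrightarrow> le L Z Y" if "Y \<in> (\<lambda>K. K <#> N) ` carrier L" "Z \<in> carrier L" for Y Z
    proof -
      have "subgroup Y G" "N \<subseteq> Y" using that sub N_sub by (auto simp: L)
      then show ?thesis using least[of Y Z] K_sub[of Z] that by (auto simp: L)
    qed
    show "average (K <#> N) \<chi> = average K \<chi>" if "K \<in> carrier L" for K
      using that by (intro average_set_mult_invariant fin sN sub \<chi>) (auto simp: L)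
  qed
  then show ?thesis by (simp add: moebius_average_def L_def)
qed

text \<open>The function is the character of the regular representation. Only the identity
  contributes to its average over K, which is |G|/|K|, the index of K by Lagrange.\<close>

lemma moebius_average_regular:
  assumes fin: "finite (carrier G)"
  shows "moebius_average G H (\<lambda>g. if g = \<one> then of_nat (Coset.order G) else 0) = of_int (dual_totient G H)"
proof -
  have "average K (\<lambda>g. if g = \<one> then of_nat (Coset.order G) else 0) = of_nat (card (rcosets K))"
    if K: "subgroup K G" for K
  proof -
    have "finite K" using K fin by (meson finite_subset subgroup.subset)
    moreover have "card K > 0" using fin by (rule subgroup.finite_imp_card_positive[OF K])
    moreover have "\<one> \<in> K" using K by (rule subgroup.one_closed)
    ultimately show ?thesis
      by (auto simp: average_def lagrange[OF K, symmetric])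
  qed
  then show ?thesis
    by (simp add: moebius_average_def dual_totient_def overgroup_lattice_def)
qed

end


section \<open>Matrices\<close>

definition trace :: "'a::comm_monoid_add mat \<Rightarrow> 'a" where
  "trace A = (\<Sum>i < dim_row A. A $$ (i, i))"

lemma trace_mult_comm:
  fixes A B :: "'a::comm_semiring_0 mat"
  assumes "A \<in> carrier_mat n m" "B \<in> carrier_mat m n"
  shows "trace (A * B) = trace (B * A)"
proof -
  have "trace (A * B) = (\<Sum>i < n. \<Sum>j < m. A $$ (i, j) * B $$ (j, i))"
    using assms by (auto simp: trace_def scalar_prod_def lessThan_atLeast0 intro!: sum.cong)
  also have "\<dots> = (\<Sum>j < m. \<Sum>i < n. B $$ (j, i) * A $$ (i, j))"
    by (subst sum.swap) (simp add: mult.commute)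
  also have "\<dots> = trace (B * A)"
    using assms by (auto simp: trace_def scalar_prod_def lessThan_atLeast0 intro!: sum.cong)
  finally show ?thesis .
qed

lemma trace_similar:
  fixes A P Q :: "'a::comm_ring_1 mat"
  assumes A: "A \<in> carrier_mat n n" and P: "P \<in> carrier_mat n n" and Q: "Q \<in> carrier_mat n n"
    and PQ: "P * Q = 1\<^sub>m n"
  shows "trace (Q * A * P) = trace A"
proof -
  have "trace (Q * A * P) = trace (P * (Q * A))"
    using assms by (intro trace_mult_comm) auto
  also have "P * (Q * A) = P * Q * A"
    by (rule assoc_mult_mat[symmetric]) fact+
  also have "\<dots> = A"
    using A PQ by simp
  finally show ?thesis .
qed

lemma trace_four_block_mat:
  assumes "A \<in> carrier_mat d d" "D \<in> carrier_mat e e"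
  shows "trace (four_block_mat A B C D) = trace A + trace D"
proof -
  have "trace (four_block_mat A B C D)
      = (\<Sum>i < d + e. if i < d then A $$ (i, i) else D $$ (i - d, i - d))"
    using assms by (auto simp: trace_def intro!: sum.cong)
  also have "\<dots> = (\<Sum>i < d. A $$ (i, i)) + (\<Sum>i < e. D $$ (i, i))"
  proof -
    have "(\<Sum>i \<in> {d..<d + e}. D $$ (i - d, i - d)) = (\<Sum>i < e. D $$ (i, i))"
      by (rule sum.reindex_bij_witness[of _ "\<lambda>i. i + d" "\<lambda>i. i - d"]) auto
    then show ?thesis
      by (simp add: lessThan_atLeast0 sum.atLeastLessThan_concat[of 0 d "d + e", symmetric])
  qed
  finally show ?thesis using assms by (simp add: trace_def)
qed

text \<open>A basis of \<open>W\<close>, extended to a basis of the whole space, supplies the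
  columns of \<open>P\<close>. Conjugation by \<open>P\<close> then turns invariance of
  \<open>W\<close> into a block of zeros.\<close>

lemma subspace_as_coordinate_subspace:
  fixes W :: "'a::field vec set"
  assumes W: "VectorSpace.subspace class_ring W (module_vec TYPE('a) n)"
  obtains d P Q where "d \<le> n" "P \<in> carrier_mat n n" "Q \<in> carrier_mat n n"
    "P * Q = 1\<^sub>m n" "Q * P = 1\<^sub>m n"
    "W = {P *\<^sub>v v | v. v \<in> carrier_vec n \<and> (\<forall>i. d \<le> i \<and> i < n \<longrightarrow> v $ i = 0)}"
proof -
  interpret vec_space "TYPE('a)" n .
  interpret W: submodule class_ring W V using W by (simp add: subspace_def)
  have W_carrier: "W \<subseteq> carrier_vec n" using W.subset by simp
  \<comment> \<open>Independent sets have at most \<open>n\<close> elements, which guarantees the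
    maximal ones chosen below.\<close>
  have bound: "finite T \<and> card T \<le> n" if "T \<subseteq> carrier_vec n" "lin_indpt T" for T
    using li_le_dim[OF fin_dim] that dim_is_n by auto
  have "\<exists>B. finite B \<and> maximal B (\<lambda>T. T \<subseteq> W \<and> lin_indpt T)"
    by (rule maximal_exists[where N = n and B = "{}"])
      (use bound W_carrier in \<open>auto simp: finite_lin_indpt2\<close>)
  then obtain B where B: "finite B" "maximal B (\<lambda>T. T \<subseteq> W \<and> lin_indpt T)" by blast
  then have BW: "B \<subseteq> W" and Bli: "lin_indpt B" by (auto simp: maximal_def)
  have spanB: "span B = W"
  proof
    show "span B \<subseteq> W" using BW W.submodule_axioms by (rule span_is_subset)
    show "W \<subseteq> span B"
    proof
      fix w assume w: "w \<in> W"
      show "w \<in> span B"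
      proof (rule ccontr)
        assume n: "w \<notin> span B"
        then have "w \<notin> B" using BW W_carrier span_mem by auto
        moreover have "lin_indpt (B \<union> {w})"
        proof -
          have "B \<subseteq> carrier_vec n" "w \<in> carrier_vec n" using BW W_carrier w by auto
          from lin_dep_iff_in_span[OF this(1) Bli this(2) \<open>w \<notin> B\<close>] n show ?thesis by simp
        qed
        moreover have "B \<union> {w} \<subseteq> W" using BW w by simp
        ultimately show False
          using B(2) unfolding maximal_def by (metis Un_upper1 Un_insert_right insertI1 sup_bot.right_neutral)
      qed
    qed
  qed
  \<comment> \<open>\<open>B\<close> is now a basis of \<open>W\<close>; it is enlarged to a basis
    \<open>C\<close> of the whole space.\<close>
  have "\<exists>C. finite C \<and> maximal C (\<lambda>T. B \<subseteq> T \<and> T \<subseteq> carrier_vec n \<and> lin_indpt T)"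
    by (rule maximal_exists[where N = n and B = B])
      (use bound W_carrier BW Bli in \<open>auto\<close>)
  then obtain C where C: "finite C" "maximal C (\<lambda>T. B \<subseteq> T \<and> T \<subseteq> carrier_vec n \<and> lin_indpt T)" by blast
  then have BC: "B \<subseteq> C" and C_carrier: "C \<subseteq> carrier_vec n" and Cli: "lin_indpt C"
    by (auto simp: maximal_def)
  have "maximal C (\<lambda>T. T \<subseteq> carrier_vec n \<and> lin_indpt T)"
    using C(2) BC unfolding maximal_def by (blast intro: order_trans)
  then have "basis C" by (rule max_li_is_basis)
  then have cardC: "card C = n" using dim_basis[of C] C(1) dim_is_n by simp
  obtain bs where bs: "set bs = B" "distinct bs" using finite_distinct_list[OF B(1)] by blast
  obtain cs where cs: "set cs = C - B" "distinct cs" using finite_distinct_list[of "C - B"] C(1) by blast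
  \<comment> \<open>The vectors of \<open>B\<close> come first, so that \<open>W\<close> corresponds
    to the first \<open>d\<close> coordinates.\<close>
  define xs where "xs = bs @ cs"
  define d where "d = length bs"
  have xs: "set xs = C" "distinct xs" using bs cs BC by (auto simp: xs_def)
  then have len: "length xs = n" using distinct_card[of xs] cardC by simp
  define P where "P = mat_of_cols n xs"
  have P: "P \<in> carrier_mat n n" using len by (auto simp: P_def)
  have colsP: "cols P = xs" using xs C_carrier unfolding P_def by (intro cols_mat_of_cols) simp
  \<comment> \<open>Independent columns give full rank, hence a nonzero determinant and an inverse
    \<open>Q\<close>.\<close>
  have "rank P = n" using lin_indpt_full_rank[OF P] colsP xs Cli by simp
  then have "det P \<noteq> 0" using det_rank_iff[OF P] by simp
  then have "P \<in> Units (ring_mat TYPE('a) n ())" using det_non_zero_imp_unit[OF P] by simp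
  then obtain Q where Q: "Q \<in> carrier_mat n n" "P * Q = 1\<^sub>m n" "Q * P = 1\<^sub>m n"
    by (auto simp: Units_def ring_mat_simps)
  let ?E = "{v \<in> carrier_vec n. \<forall>i. d \<le> i \<and> i < n \<longrightarrow> v $ i = 0}"
  have dn: "d \<le> n" using len by (simp add: d_def xs_def)
  \<comment> \<open>\<open>A\<close> consists of the first \<open>d\<close> columns of
    \<open>P\<close>. On vectors whose coordinates vanish from \<open>d\<close> on, \<open>P\<close>
    acts as \<open>A\<close>, so its values there are the combinations of \<open>B\<close>.\<close>
  define A where "A = mat_of_cols n bs"
  have A: "A \<in> carrier_mat n d" by (auto simp: A_def d_def)
  have colsA: "cols A = bs" using bs BW W_carrier unfolding A_def by (intro cols_mat_of_cols) auto
  have Pv: "P *\<^sub>v v = A *\<^sub>v vec d (\<lambda>i. v $ i)" if v: "v \<in> ?E" for v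
  proof (rule eq_vecI)
    fix i assume "i < dim_vec (A *\<^sub>v vec d (\<lambda>i. v $ i))"
    then have i: "i < n" using A by simp
    have "(P *\<^sub>v v) $ i = (\<Sum>j \<in> {0..<n}. P $$ (i, j) * v $ j)"
      using i P v by (auto simp: scalar_prod_def intro!: sum.cong)
    also have "\<dots> = (\<Sum>j \<in> {0..<d}. P $$ (i, j) * v $ j)"
      using v dn by (intro sum.mono_neutral_right) auto
    also have "\<dots> = (\<Sum>j \<in> {0..<d}. A $$ (i, j) * v $ j)"
      using i dn len by (intro sum.cong) (auto simp: P_def A_def mat_of_cols_index xs_def d_def nth_append)
    also have "\<dots> = (A *\<^sub>v vec d (\<lambda>i. v $ i)) $ i"
      using i A by (auto simp: scalar_prod_def intro!: sum.cong)
    finally show "(P *\<^sub>v v) $ i = (A *\<^sub>v vec d (\<lambda>i. v $ i)) $ i" .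
  qed (use A P in auto)
  have Adist: "distinct (cols A)" and Aset: "set (cols A) = B" using colsA bs by auto
  have "W = {P *\<^sub>v v | v. v \<in> ?E}"
  proof (intro equalityI subsetI)
    fix w assume "w \<in> W"
    then have "w \<in> span B" by (simp add: spanB)
    then obtain a where w: "w = lincomb a B"
      using finite_in_span[OF B(1)] BW W_carrier by blast
    \<comment> \<open>The coefficients of \<open>w\<close> in the basis \<open>B\<close>, padded
      with zeros.\<close>
    define v where "v = vec n (\<lambda>i. if i < d then a (col A i) else 0)"
    have v: "v \<in> ?E" by (auto simp: v_def)
    have "vec d (\<lambda>i. v $ i) = vec d (\<lambda>i. a (col A i))" using dn by (auto simp: v_def)
    then have "A *\<^sub>v vec d (\<lambda>i. v $ i) = w"
      using mat_mult_eq_lincomb[OF A Adist, of a] w Aset by simp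
    then have "w = P *\<^sub>v v" using Pv[OF v] by simp
    with v show "w \<in> {P *\<^sub>v v | v. v \<in> ?E}" by blast
  next
    fix w assume "w \<in> {P *\<^sub>v v | v. v \<in> ?E}"
    then obtain v where v: "v \<in> ?E" "w = P *\<^sub>v v" by blast
    \<comment> \<open>The coefficient of a basis vector is the entry of \<open>v\<close> at the
      position of that vector among the columns of \<open>A\<close>.\<close>
    have "w = lincomb (\<lambda>a. vec d (\<lambda>i. v $ i) $ find_first a (cols A)) B"
      using lincomb_eq_mat_mult[OF A _ Adist, of "vec d (\<lambda>i. v $ i)"] Pv[OF v(1)] v(2) Aset by simp
    then have "w \<in> span B" using B(1) unfolding span_def by blast
    then show "w \<in> W" by (simp add: spanB)
  qed
  then show thesis using that[OF dn P Q] by simp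
qed


section \<open>Representations\<close>

context group
begin

text \<open>Invertibility is absorbed into the condition at the identity: given multiplicativity,
  \<rho>(inv g) is then a two-sided inverse of \<rho>(g).\<close>

lemma representation_iff:
  "representation G n \<rho> \<longleftrightarrow>
     (\<forall>g \<in> carrier G. \<rho> g \<in> carrier_mat n n) \<and> \<rho> \<one> = 1\<^sub>m n \<and>
     (\<forall>g \<in> carrier G. \<forall>h \<in> carrier G. \<rho> (g \<otimes> h) = \<rho> g * \<rho> h)"
  (is "_ \<longleftrightarrow> ?R")
proof
  interpret M: ring "ring_mat TYPE(complex) n ()" by (rule ring_mat)
  assume hom: "representation G n \<rho>"
  have "\<rho> \<one> = 1\<^sub>m n"
    using hom_one[OF _ is_group M.units_group, of \<rho>] hom
    by (simp add: representation_def units_of_one ring_mat_simps)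
  with hom show ?R
    by (auto simp: representation_def hom_def units_of_def Units_def ring_mat_simps)
next
  assume R: ?R
  have "\<exists>B \<in> carrier_mat n n. B * \<rho> g = 1\<^sub>m n \<and> \<rho> g * B = 1\<^sub>m n" if "g \<in> carrier G" for g
  proof (rule bexI[of _ "\<rho> (inv g)"])
    show "\<rho> (inv g) * \<rho> g = 1\<^sub>m n \<and> \<rho> g * \<rho> (inv g) = 1\<^sub>m n"
      using R that by (metis inv_closed l_inv r_inv)
  qed (use R that in simp)
  with R show "representation G n \<rho>"
    by (auto simp: representation_def hom_def units_of_def Units_def ring_mat_simps)
qed

lemma representation_group_hom:
  assumes "representation G n \<rho>"
  shows "group_hom G (general_linear_group n) \<rho>"
proof -
  interpret M: ring "ring_mat TYPE(complex) n ()" by (rule ring_mat)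
  show ?thesis
    using assms M.units_group is_group
    by (simp add: group_hom_def group_hom_axioms_def representation_def)
qed

text \<open>Permutation matrices of left multiplication, with rows and columns indexed through an
  enumeration \<open>e\<close> of the group. The trace counts the solutions x of gx = x, which exist
  only for g = 1.\<close>

lemma regular_representation:
  assumes fin: "finite (carrier G)"
  obtains \<rho> where "representation G (Coset.order G) \<rho>"
    "\<And>g. g \<in> carrier G \<Longrightarrow> trace (\<rho> g) = (if g = \<one> then of_nat (Coset.order G) else 0)"
proof -
  let ?n = "Coset.order G"
  obtain e where e: "bij_betw e {0..<?n} (carrier G)"
    using ex_bij_betw_nat_finite[OF fin] by (auto simp: Coset.order_def)
  have e_mem: "e i \<in> carrier G" if "i < ?n" for i
    using e that by (auto simp: bij_betw_def)
  have e_inj: "e i = e j \<longleftrightarrow> i = j" if "i < ?n" "j < ?n" for i j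
    using e that by (auto simp: bij_betw_def inj_on_def)
  define \<rho> :: "'a \<Rightarrow> complex mat" where
    "\<rho> g = mat ?n ?n (\<lambda>(i, j). if e i = g \<otimes> e j then 1 else 0)" for g
  have mult: "\<rho> (g \<otimes> h) = \<rho> g * \<rho> h" if g: "g \<in> carrier G" and h: "h \<in> carrier G" for g h
  proof (rule eq_matI)
    fix i j assume "i < dim_row (\<rho> g * \<rho> h)" "j < dim_col (\<rho> g * \<rho> h)"
    then have ij: "i < ?n" "j < ?n" by (auto simp: \<rho>_def)
    have "h \<otimes> e j \<in> e ` {0..<?n}" using e e_mem[OF ij(2)] h by (simp add: bij_betw_def)
    then obtain k where k: "k < ?n" "e k = h \<otimes> e j" by auto
    have "(\<rho> g * \<rho> h) $$ (i, j) = (\<Sum>l \<in> {0..<?n}. \<rho> g $$ (i, l) * \<rho> h $$ (l, j))"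
      using ij by (simp add: \<rho>_def scalar_prod_def)
    \<comment> \<open>Column \<open>j\<close> of \<rho>(h) has its single nonzero entry in the row
      \<open>k\<close> with \<open>e k = h \<otimes> e j\<close>.\<close>
    also have "\<dots> = (\<Sum>l \<in> {0..<?n}. if l = k then \<rho> g $$ (i, k) else 0)"
      using ij k by (intro sum.cong) (auto simp: \<rho>_def k(2)[symmetric] e_inj)
    also have "\<dots> = \<rho> g $$ (i, k)" using k by simp
    also have "\<dots> = \<rho> (g \<otimes> h) $$ (i, j)"
      using ij k g h e_mem by (simp add: \<rho>_def m_assoc)
    finally show "\<rho> (g \<otimes> h) $$ (i, j) = (\<rho> g * \<rho> h) $$ (i, j)" by simp
  qed (auto simp: \<rho>_def)
  have one: "\<rho> \<one> = 1\<^sub>m ?n"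
    by (rule eq_matI) (auto simp: \<rho>_def e_mem e_inj)
  have "representation G ?n \<rho>"
    unfolding representation_iff using mult one by (auto simp: \<rho>_def)
  moreover have "trace (\<rho> g) = (if g = \<one> then of_nat ?n else 0)" if g: "g \<in> carrier G" for g
  proof -
    have "e i = g \<otimes> e i \<longleftrightarrow> g = \<one>" if "i < ?n" for i
      using e_mem[OF that] g by (metis l_one one_closed right_cancel)
    then have "trace (\<rho> g) = (\<Sum>i < ?n. if g = \<one> then 1 else 0)"
      by (auto simp: trace_def \<rho>_def intro!: sum.cong)
    then show ?thesis by simp
  qed
  ultimately show thesis by (rule that)
qed

section \<open>Splitting a character along an invariant subspace\<close>

lemma representation_similar:
  assumes \<rho>: "representation G n \<rho>" and P: "P \<in> carrier_mat n n" and Q: "Q \<in> carrier_mat n n"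
    and PQ: "P * Q = 1\<^sub>m n" and QP: "Q * P = 1\<^sub>m n"
  shows "representation G n (\<lambda>g. Q * \<rho> g * P)"
  unfolding representation_iff
proof (intro conjI ballI)
  show "Q * \<rho> g * P \<in> carrier_mat n n" if "g \<in> carrier G" for g
    using \<rho> P Q that by (auto simp: representation_iff)
  show "Q * \<rho> \<one> * P = 1\<^sub>m n"
    using \<rho> Q QP by (simp add: representation_iff)
  fix g h assume gh: "g \<in> carrier G" "h \<in> carrier G"
  then have c: "\<rho> g \<in> carrier_mat n n" "\<rho> h \<in> carrier_mat n n"
    and hom: "\<rho> (g \<otimes> h) = \<rho> g * \<rho> h" using \<rho> by (auto simp: representation_iff)
  have "Q * \<rho> g * P * (Q * \<rho> h * P) = Q * \<rho> g * (P * Q) * (\<rho> h * P)"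
    using c P Q by (simp add: assoc_mult_mat[of _ n n _ n _ n])
  also have "\<dots> = Q * \<rho> (g \<otimes> h) * P"
    using c P Q PQ by (simp add: assoc_mult_mat[of _ n n _ n _ n] hom)
  finally show "Q * \<rho> (g \<otimes> h) * P = Q * \<rho> g * P * (Q * \<rho> h * P)" by simp
qed

text \<open>\<open>A\<close> is the action on the invariant subspace and \<open>D\<close> the action
  on the quotient by it. Diagonal blocks of block triangular matrices multiply separately.\<close>

lemma representation_block_triangular:
  assumes \<rho>: "representation G (d + e) \<rho>"
    and A: "\<And>g. g \<in> carrier G \<Longrightarrow> A g \<in> carrier_mat d d"
    and B: "\<And>g. g \<in> carrier G \<Longrightarrow> B g \<in> carrier_mat d e"
    and D: "\<And>g. g \<in> carrier G \<Longrightarrow> D g \<in> carrier_mat e e"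
    and block: "\<And>g. g \<in> carrier G \<Longrightarrow> \<rho> g = four_block_mat (A g) (B g) (0\<^sub>m e d) (D g)"
  shows "representation G d A" "representation G e D"
proof -
  \<comment> \<open>With the block sizes fixed, a block matrix determines its diagonal blocks, so
    the homomorphism equations can be read off block by block.\<close>
  have inj: "A1 = A2 \<and> D1 = D2"
    if "four_block_mat A1 B1 (0\<^sub>m e d) D1 = four_block_mat A2 B2 (0\<^sub>m e d) D2"
      and "A1 \<in> carrier_mat d d" "A2 \<in> carrier_mat d d" "D1 \<in> carrier_mat e e" "D2 \<in> carrier_mat e e"
    for A1 A2 B1 B2 and D1 D2 :: "complex mat"
  proof
    have eq: "four_block_mat A1 B1 (0\<^sub>m e d) D1 $$ (i, j) = four_block_mat A2 B2 (0\<^sub>m e d) D2 $$ (i, j)" for i j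
      using that(1) by simp
    show "A1 = A2"
    proof (rule eq_matI)
      show "A1 $$ (i, j) = A2 $$ (i, j)" if "i < dim_row A2" "j < dim_col A2" for i j
        using eq[of i j] that \<open>A1 \<in> _\<close> \<open>A2 \<in> _\<close> \<open>D1 \<in> _\<close> \<open>D2 \<in> _\<close> by simp
    qed (use that in auto)
    show "D1 = D2"
    proof (rule eq_matI)
      show "D1 $$ (i, j) = D2 $$ (i, j)" if "i < dim_row D2" "j < dim_col D2" for i j
        using eq[of "i + d" "j + d"] that \<open>A1 \<in> _\<close> \<open>A2 \<in> _\<close> \<open>D1 \<in> _\<close> \<open>D2 \<in> _\<close> by simp
    qed (use that in auto)
  qed
  have "four_block_mat (A \<one>) (B \<one>) (0\<^sub>m e d) (D \<one>)
      = four_block_mat (1\<^sub>m d) (0\<^sub>m d e) (0\<^sub>m e d) (1\<^sub>m e)"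
    using \<rho> block[of \<one>] by (simp add: representation_iff)
  then have one: "A \<one> = 1\<^sub>m d \<and> D \<one> = 1\<^sub>m e"
    by (rule inj) (use A D in auto)
  have mult: "A (g \<otimes> h) = A g * A h \<and> D (g \<otimes> h) = D g * D h"
    if gh: "g \<in> carrier G" "h \<in> carrier G" for g h
  proof (rule inj)
    note c = A[OF gh(1)] B[OF gh(1)] D[OF gh(1)] A[OF gh(2)] B[OF gh(2)] D[OF gh(2)]
    have "four_block_mat (A (g \<otimes> h)) (B (g \<otimes> h)) (0\<^sub>m e d) (D (g \<otimes> h)) = \<rho> g * \<rho> h"
      using gh \<rho> block[of "g \<otimes> h"] by (simp add: representation_iff)
    also have "\<dots> = four_block_mat (A g * A h) (A g * B h + B g * D h) (0\<^sub>m e d) (D g * D h)"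
      using c by (simp add: block gh mult_four_block_mat[OF c(1,2) _ c(3) c(4,5) _ c(6)])
    finally show "four_block_mat (A (g \<otimes> h)) (B (g \<otimes> h)) (0\<^sub>m e d) (D (g \<otimes> h))
      = four_block_mat (A g * A h) (A g * B h + B g * D h) (0\<^sub>m e d) (D g * D h)" .
  qed (use A D gh in \<open>auto intro!: mult_carrier_mat\<close>)
  show "representation G d A" "representation G e D"
    using A D one mult by (auto simp: representation_iff)
qed

text \<open>In a basis adapted to \<open>W\<close> all matrices of the representation are
  simultaneously block upper triangular, and the trace is the sum of those of the diagonal blocks.
  Both blocks are smaller than \<open>n\<close> because \<open>W\<close> is neither zero nor the
  whole space.\<close>

lemma reducible_trace:
  assumes \<rho>: "representation G n \<rho>"
    and W: "VectorSpace.subspace class_ring W (module_vec TYPE(complex) n)"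
    and inv: "\<forall>g \<in> carrier G. \<forall>w \<in> W. \<rho> g *\<^sub>v w \<in> W"
    and nontrivial: "W \<noteq> {0\<^sub>v n}" "W \<noteq> carrier_vec n"
  obtains d e A D where "d < n" "e < n" "representation G d A" "representation G e D"
    "\<And>g. g \<in> carrier G \<Longrightarrow> trace (\<rho> g) = trace (A g) + trace (D g)"
proof -
  obtain d P Q where dn: "d \<le> n" and P: "P \<in> carrier_mat n n" and Q: "Q \<in> carrier_mat n n"
    and PQ: "P * Q = 1\<^sub>m n" and QP: "Q * P = 1\<^sub>m n"
    and W_eq: "W = {P *\<^sub>v v | v. v \<in> carrier_vec n \<and> (\<forall>i. d \<le> i \<and> i < n \<longrightarrow> v $ i = 0)}"
    using subspace_as_coordinate_subspace[OF W] .
  have "d \<noteq> 0"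
  proof
    assume "d = 0"
    then have "W = {P *\<^sub>v 0\<^sub>v n}"
      unfolding W_eq by (auto intro!: exI[of _ "0\<^sub>v n"] arg_cong[where f = "\<lambda>v. P *\<^sub>v v"])
    moreover have "P *\<^sub>v 0\<^sub>v n = 0\<^sub>v n" using P by (intro eq_vecI) auto
    ultimately show False using nontrivial(1) by simp
  qed
  have "d \<noteq> n"
  proof
    assume "d = n"
    have "w \<in> W" if "w \<in> carrier_vec n" for w
    proof -
      have "w = P *\<^sub>v (Q *\<^sub>v w)" using that P Q PQ by (simp flip: assoc_mult_mat_vec)
      then show ?thesis using \<open>d = n\<close> that Q unfolding W_eq by auto
    qed
    then show False using nontrivial(2) P unfolding W_eq by auto
  qed
  define M where "M g = Q * \<rho> g * P" for g
  have \<rho>_carrier: "\<rho> g \<in> carrier_mat n n" if "g \<in> carrier G" for g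
    using \<rho> that by (simp add: representation_iff)
  have M: "representation G n M"
    unfolding M_def by (rule representation_similar) fact+
  have M_carrier: "M g \<in> carrier_mat n n" if "g \<in> carrier G" for g
    using M that by (simp add: representation_iff)
  \<comment> \<open>For j < d, \<open>P\<close> sends the j-th unit vector into \<open>W\<close>,
    the representation keeps it there, and \<open>Q\<close> returns a vector whose coordinates from
    \<open>d\<close> on vanish. This vector is column j of \<open>M g\<close>.\<close>
  have lower_left: "M g $$ (i, j) = 0" if g: "g \<in> carrier G" and i: "d \<le> i" "i < n" and j: "j < d" for g i j
  proof -
    have "P *\<^sub>v unit_vec n j \<in> W" using j unfolding W_eq by auto
    then have "\<rho> g *\<^sub>v (P *\<^sub>v unit_vec n j) \<in> W" using inv g by blast
    then obtain v where v: "\<rho> g *\<^sub>v (P *\<^sub>v unit_vec n j) = P *\<^sub>v v" "v \<in> carrier_vec n" "v $ i = 0"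
      using i unfolding W_eq by auto
    have "col (M g) j = M g *\<^sub>v unit_vec n j"
      using M_carrier[OF g] j dn by (intro eq_vecI) auto
    also have "\<dots> = Q *\<^sub>v (\<rho> g *\<^sub>v (P *\<^sub>v unit_vec n j))"
      using P Q \<rho>_carrier[OF g] by (simp add: M_def assoc_mult_mat_vec[of _ n n _ n])
    also have "\<dots> = v"
      using P Q v QP by (simp flip: assoc_mult_mat_vec)
    finally show ?thesis
      using v(3) M_carrier[OF g] i j dn by (metis carrier_matD index_col order_less_le_trans)
  qed
  define e where "e = n - d"
  have n: "n = d + e" using dn by (simp add: e_def)
  define A where "A g = mat d d (\<lambda>(i, j). M g $$ (i, j))" for g
  define B where "B g = mat d e (\<lambda>(i, j). M g $$ (i, j + d))" for g
  define D where "D g = mat e e (\<lambda>(i, j). M g $$ (i + d, j + d))" for g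
  have block: "M g = four_block_mat (A g) (B g) (0\<^sub>m e d) (D g)" if g: "g \<in> carrier G" for g
    using M_carrier[OF g] lower_left[OF g] n
    by (intro eq_matI) (auto simp: A_def B_def D_def)
  have reps: "representation G d A" "representation G e D"
    by (rule representation_block_triangular[OF M[unfolded n], of A B D];
        use block in \<open>auto simp: A_def B_def D_def\<close>)+
  have "trace (\<rho> g) = trace (A g) + trace (D g)" if g: "g \<in> carrier G" for g
  proof -
    have "trace (\<rho> g) = trace (M g)"
      unfolding M_def by (rule trace_similar[OF \<rho>_carrier[OF g] P Q PQ, symmetric])
    also have "\<dots> = trace (A g) + trace (D g)"
      unfolding block[OF g] by (rule trace_four_block_mat) (auto simp: A_def D_def)
    finally show ?thesis .
  qed
  moreover have "d < n" "e < n" using dn \<open>d \<noteq> 0\<close> \<open>d \<noteq> n\<close> by (auto simp: e_def)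
  ultimately show thesis using that reps by blast
qed

section \<open>Kernels and faithfulness\<close>

lemma kernel_normal:
  assumes \<rho>: "representation G n \<rho>"
  shows "{g \<in> carrier G. \<rho> g = 1\<^sub>m n} \<lhd> G"
proof -
  interpret \<rho>: group_hom G "general_linear_group n" \<rho>
    using \<rho> by (rule representation_group_hom)
  show ?thesis
    using \<rho>.normal_kernel by (simp add: kernel_def units_of_one ring_mat_simps)
qed

lemma inj_on_representation:
  assumes \<rho>: "representation G n \<rho>" and ker: "{g \<in> carrier G. \<rho> g = 1\<^sub>m n} = {\<one>}"
  shows "inj_on \<rho> (carrier G)"
proof -
  interpret \<rho>: group_hom G "general_linear_group n" \<rho>
    using \<rho> by (rule representation_group_hom)
  show ?thesis
    using ker by (intro \<rho>.trivial_ker_imp_inj) (simp add: kernel_def units_of_one ring_mat_simps)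
qed

end


section \<open>Linear primitivity\<close>

theorem theorem3p24:
  fixes G (structure) and H :: "'a set"
  assumes "group G"
    and "finite (carrier G)"
    and "core_free G H"
    and "bottom_boolean (overgroup_lattice G H)"
    and "dual_totient G H \<noteq> 0"
  shows "linearly_primitive G"
proof -
  interpret group G by fact
  have H: "subgroup H G" using assms(3) by (simp add: core_free_def)
  define P where "P n \<longleftrightarrow> (\<exists>\<rho>. representation G n \<rho> \<and> moebius_average G H (\<lambda>g. trace (\<rho> g)) \<noteq> 0)" for n
  \<comment> \<open>The regular representation shows that some degree satisfies \<open>P\<close>,
    since its Moebius average is the nonzero dual totient.\<close>
  obtain \<rho>0 where "representation G (Coset.order G) \<rho>0"
    "\<And>g. g \<in> carrier G \<Longrightarrow> trace (\<rho>0 g) = (if g = \<one> then of_nat (Coset.order G) else 0)"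
    using regular_representation[OF assms(2)] by blast
  then have "P (Coset.order G)"
    using moebius_average_regular[OF assms(2), of H] assms(5)
    by (auto simp: P_def cong: moebius_average_cong)
  define n where "n = (LEAST n. P n)"
  have "P n" unfolding n_def by (rule LeastI) fact
  have minimal: "\<not> P m" if "m < n" for m using that not_less_Least unfolding n_def by blast
  obtain \<rho> where \<rho>: "representation G n \<rho>" and nonzero: "moebius_average G H (\<lambda>g. trace (\<rho> g)) \<noteq> 0"
    using \<open>P n\<close> by (auto simp: P_def)
  have \<rho>_carrier: "\<rho> g \<in> carrier_mat n n" if "g \<in> carrier G" for g
    using \<rho> that by (simp add: representation_iff)
  have "n > 0"
  proof (rule ccontr)
    assume "\<not> n > 0"
    \<comment> \<open>Degree 0 is a legitimate \<open>representation\<close>, but its character is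
      zero.\<close>
    then have "trace (\<rho> g) = 0" if "g \<in> carrier G" for g using \<rho>_carrier[OF that] by (simp add: trace_def)
    then have "moebius_average G H (\<lambda>g. trace (\<rho> g)) = moebius_average G H (\<lambda>g. 0)"
      by (rule moebius_average_cong)
    then show False using nonzero by (simp add: moebius_average_def average_def)
  qed
  have "W = {0\<^sub>v n} \<or> W = carrier_vec n"
    if W: "VectorSpace.subspace class_ring W (module_vec TYPE(complex) n)"
      "\<forall>g \<in> carrier G. \<forall>w \<in> W. \<rho> g *\<^sub>v w \<in> W" for W
  proof (rule ccontr)
    assume "\<not> ?thesis"
    then obtain d e A D where "d < n" "e < n" "representation G d A" "representation G e D"
      and tr: "\<And>g. g \<in> carrier G \<Longrightarrow> trace (\<rho> g) = trace (A g) + trace (D g)"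
      using reducible_trace[OF \<rho> W] by blast
    \<comment> \<open>Both blocks have degree below the minimum, so neither contributes to the
      Moebius average.\<close>
    then have "moebius_average G H (\<lambda>g. trace (A g)) = 0" "moebius_average G H (\<lambda>g. trace (D g)) = 0"
      using minimal by (auto simp: P_def)
    then have "moebius_average G H (\<lambda>g. trace (A g) + trace (D g)) = 0"
      by (simp add: moebius_average_add)
    then show False using nonzero moebius_average_cong[of G "\<lambda>g. trace (\<rho> g)", OF tr] by simp
  qed
  then have irreducible: "irreducible_representation G n \<rho>"
    using \<rho> \<open>n > 0\<close> by (simp add: irreducible_representation_def)
  define N where "N = {g \<in> carrier G. \<rho> g = 1\<^sub>m n}"
  have N: "N \<lhd> G" unfolding N_def using \<rho> by (rule kernel_normal)
  have "N \<subseteq> H"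
  proof (rule ccontr)
    assume "\<not> N \<subseteq> H"
    then have "moebius_average G H (\<lambda>g. trace (\<rho> g)) = 0"
    proof (rule moebius_average_normal_invariant[OF assms(2) H N])
      \<comment> \<open>Elements of the kernel act as the identity matrix, so the character is
        constant on the cosets of \<open>N\<close>.\<close>
      show "trace (\<rho> (g \<otimes> h)) = trace (\<rho> g)" if "g \<in> carrier G" "h \<in> N" for g h
        using that \<rho> right_mult_one_mat[OF \<rho>_carrier] by (simp add: representation_iff N_def)
    qed
    then show False using nonzero by contradiction
  qed
  then have "N = {\<one>}" using assms(3) N by (simp add: core_free_def)
  then have "inj_on \<rho> (carrier G)"
    using inj_on_representation[OF \<rho>] by (simp add: N_def)
  then show ?thesis
    using \<rho> irreducible by (auto simp: linearly_primitive_def faithful_representation_def)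
qed

end
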